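(* Let $H$ be a real Hilbert space and let $f, g \in \Gamma_0(H)$ be such that $\mathrm{dom}(f) \cap \mathrm{dom}(g) \neq \emptyset$. Then $\mathrm{D}(\mathrm{prox}^f_g) = H$ if and only if the additivity condition $\partial(f+g) = \partial f + \partial g$ is satisfied.
   Context: $\Gamma_0(H)$ is the set of proper, lower semicontinuous, convex functions $H \to \mathbb{R} \cup \{+\infty\}$. For $g : H \to \mathbb{R}\cup\{+\infty\}$, $\mathrm{dom}(g) = \{x \in H : g(x) < +\infty\}$. For $g \in \Gamma_0(H)$, the subdifferential is the set-valued map $\partial g(x) = \{ y \in H : \langle y, z-x\rangle \le g(z)-g(x)\ \forall z \in H\}$. Sums of set-valued maps are pointwise Minkowski sums (empty if one of the summands is empty), and $\partial(f+g)=\partial f+\partial g$ means equality at every point of $H$. For a set-valued map $A : H \rightrightarrows H$, $\mathrm{D}(A) = \{x \in H : A(x) \neq \emptyset\}$ and $A^{-1}(y) = \{x \in H : y \in A(x)\}$; $I$ is the identity operator. The proximal operator of $f \in \Gamma_0(H)$ is $\mathrm{prox}_f = (I+\partial f)^{-1}$, which is single-valued and defined everywhere on $H$. The $f$-proximal operator of $g$ is the set-valued map $\mathrm{prox}^f_g : H \rightrightarrows H$ defined by $\mathrm{prox}^f_g = (I + \partial g \circ \mathrm{prox}_f)^{-1}$; that is, $y \in \mathrm{prox}^f_g(x)$ if and only if $x - y \in \partial g(\mathrm{prox}_f(y))$. *)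

theory Defs
  imports "HOL-Analysis.Analysis" "HOL-Library.Set_Algebras"
begin

text \<open>
  Functions with values in the reals extended by \<open>+\<infinity>\<close> are functions into \<^typ>\<open>ereal\<close> that
  never take the value \<open>-\<infinity>\<close>; this is part of \<open>proper\<close>. Hence \<open>f x + g x\<close> is unambiguous.
\<close>

definition effective_domain :: "('h \<Rightarrow> ereal) \<Rightarrow> 'h set" where
  "effective_domain g = {x. g x < \<infinity>}"

definition proper :: "('h \<Rightarrow> ereal) \<Rightarrow> bool" where
  "proper g \<longleftrightarrow> (\<forall>x. g x \<noteq> - \<infinity>) \<and> effective_domain g \<noteq> {}"

definition lower_semicontinuous :: "('h::topological_space \<Rightarrow> ereal) \<Rightarrow> bool" where
  "lower_semicontinuous g \<longleftrightarrow> (\<forall>x. g x \<le> Liminf (nhds x) g)"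

text \<open>Since \<open>0 * \<infinity> = 0\<close> in \<^typ>\<open>ereal\<close>, the weights 0 and 1 are harmless here.\<close>

definition convex_fun :: "('h::real_vector \<Rightarrow> ereal) \<Rightarrow> bool" where
  "convex_fun g \<longleftrightarrow>
     (\<forall>x y. \<forall>u\<ge>0. \<forall>v\<ge>0. u + v = 1 \<longrightarrow>
        g (u *\<^sub>R x + v *\<^sub>R y) \<le> ereal u * g x + ereal v * g y)"

definition Gamma0 :: "('h::{real_inner, complete_space} \<Rightarrow> ereal) set" where
  "Gamma0 = {g. proper g \<and> lower_semicontinuous g \<and> convex_fun g}"

text \<open>
  In \<^typ>\<open>ereal\<close>, \<open>\<infinity> - \<infinity> = \<infinity>\<close>. For proper \<open>g\<close> this does not matter: if \<open>g x = \<infinity>\<close>, then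
  any \<open>z\<close> in the effective domain gives \<open>g z - g x = -\<infinity>\<close>, so the subdifferential at \<open>x\<close> is empty.
\<close>

definition subdifferential :: "('h::real_inner \<Rightarrow> ereal) \<Rightarrow> 'h \<Rightarrow> 'h set" where
  "subdifferential g x = {y. \<forall>z. ereal (y \<bullet> (z - x)) \<le> g z - g x}"

text \<open>A set-valued map from \<open>H\<close> to \<open>H\<close> is a function of type \<open>'h \<Rightarrow> 'h set\<close>.\<close>

definition op_domain :: "('h \<Rightarrow> 'h set) \<Rightarrow> 'h set" where
  "op_domain A = {x. A x \<noteq> {}}"

definition op_inverse :: "('h \<Rightarrow> 'h set) \<Rightarrow> 'h \<Rightarrow> 'h set" where
  "op_inverse A y = {x. y \<in> A x}"

definition op_comp :: "('h \<Rightarrow> 'h set) \<Rightarrow> ('h \<Rightarrow> 'h set) \<Rightarrow> 'h \<Rightarrow> 'h set" where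
  "op_comp A B x = (\<Union>p\<in>B x. A p)"

definition op_add :: "('h::plus \<Rightarrow> 'h set) \<Rightarrow> ('h \<Rightarrow> 'h set) \<Rightarrow> 'h \<Rightarrow> 'h set" where
  "op_add A B x = A x + B x"

definition op_id :: "'h \<Rightarrow> 'h set" where
  "op_id x = {x}"

text \<open>
  The proximal operator is kept as a set-valued map, \<open>(I + \<partial>f)\<^sup>-\<^sup>1\<close>; its values have at most one
  element by \<open>prox_unique\<close> below.
\<close>

definition prox :: "('h::real_inner \<Rightarrow> ereal) \<Rightarrow> 'h \<Rightarrow> 'h set" where
  "prox f = op_inverse (op_add op_id (subdifferential f))"

definition prox_rel :: "('h::real_inner \<Rightarrow> ereal) \<Rightarrow> ('h \<Rightarrow> ereal) \<Rightarrow> 'h \<Rightarrow> 'h set" where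
  "prox_rel f g = op_inverse (op_add op_id (op_comp (subdifferential g) (prox f)))"

lemma mem_prox_iff: "p \<in> prox f x \<longleftrightarrow> x - p \<in> subdifferential f p"
  by (auto simp: prox_def op_inverse_def op_add_def op_id_def set_plus_def algebra_simps)
    (metis add_diff_cancel_left' diff_add_cancel add.commute)+

lemma mem_prox_rel_iff:
  "y \<in> prox_rel f g x \<longleftrightarrow> (\<exists>p \<in> prox f y. x - y \<in> subdifferential g p)"
proof -
  have "y \<in> prox_rel f g x \<longleftrightarrow> (\<exists>p \<in> prox f y. \<exists>v \<in> subdifferential g p. x = y + v)"
    by (auto simp: prox_rel_def op_inverse_def op_add_def op_id_def op_comp_def set_plus_def)
  also have "\<dots> \<longleftrightarrow> (\<exists>p \<in> prox f y. x - y \<in> subdifferential g p)"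
    by (metis add_diff_cancel_left' diff_add_cancel add.commute)
  finally show ?thesis .
qed

lemma subdifferential_finite:
  assumes "proper g" "y \<in> subdifferential g x"
  shows "\<bar>g x\<bar> \<noteq> \<infinity>"
proof -
  obtain z where z: "g z < \<infinity>"
    using assms(1) by (auto simp: proper_def effective_domain_def)
  have ninf: "g z \<noteq> - \<infinity>" "g x \<noteq> - \<infinity>"
    using assms(1) by (auto simp: proper_def)
  have "ereal (y \<bullet> (z - x)) \<le> g z - g x"
    using assms(2) by (auto simp: subdifferential_def)
  then show ?thesis
    using z ninf by (cases "g x"; cases "g z") auto
qed

lemma prox_unique:
  assumes "proper f" "p \<in> prox f x" "q \<in> prox f x"
  shows "p = q"
proof -
  have p: "x - p \<in> subdifferential f p" and q: "x - q \<in> subdifferential f q"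
    using assms(2,3) by (auto simp: mem_prox_iff)
  obtain a b where ab: "f p = ereal a" "f q = ereal b"
    using subdifferential_finite[OF assms(1) p] subdifferential_finite[OF assms(1) q]
    by (cases "f p"; cases "f q") auto
  have "ereal ((x - p) \<bullet> (q - p)) \<le> f q - f p" "ereal ((x - q) \<bullet> (p - q)) \<le> f p - f q"
    using p q by (auto simp: subdifferential_def)
  then have "(x - p) \<bullet> (q - p) \<le> b - a" "(x - q) \<bullet> (p - q) \<le> a - b"
    by (simp_all add: ab)
  then have "(x - p) \<bullet> (q - p) + (x - q) \<bullet> (p - q) \<le> 0"
    by linarith
  moreover have "(x - p) \<bullet> (q - p) + (x - q) \<bullet> (p - q) = (p - q) \<bullet> (p - q)"
    by (simp add: inner_diff_left inner_diff_right inner_commute)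
  ultimately have "(p - q) \<bullet> (p - q) = 0"
    using inner_ge_zero[of "p - q"] by linarith
  then show ?thesis
    by simp
qed

end

theory Submission
  imports Defs
begin

text \<open>
  Put \<open>p = prox f y\<close>, that is, \<open>y - p \<in> \<partial>f p\<close>. Then \<open>y \<in> prox_rel f g x\<close> says that
  \<open>x - p = (y - p) + (x - y)\<close> splits into an element of \<open>\<partial>f p\<close> and one of \<open>\<partial>g p\<close>. Hence the
  \<open>f\<close>-proximal operator of \<open>g\<close> has full domain if and only if \<open>I + \<partial>f + \<partial>g\<close> is onto
  (\<open>op_domain_prox_rel_iff\<close>).

  The map \<open>I + \<partial>(f + g)\<close> always is onto, since \<open>f + g\<close> is again proper, lower semicontinuous and
  convex (\<open>Gamma0_add\<close>) and the proximal operator of such a function is defined everywhere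
  (\<open>prox_exists\<close>). So additivity gives full domain. Conversely, \<open>\<partial>f + \<partial>g\<close> is always contained in
  \<open>\<partial>(f + g)\<close> (\<open>op_add_subdifferential_subset\<close>), and it cannot be strictly smaller when
  \<open>I + \<partial>f + \<partial>g\<close> is onto: for \<open>u \<in> \<partial>(f + g) p\<close>, the point \<open>p + u\<close> is attained by
  \<open>I + \<partial>f + \<partial>g\<close> at some \<open>q\<close>, then both \<open>p\<close> and \<open>q\<close> belong to \<open>prox (f + g) (p + u)\<close>, which has
  at most one element, and therefore \<open>u \<in> \<partial>f p + \<partial>g p\<close>. This is the usual argument that a monotone
  operator with \<open>I + A\<close> onto is maximal.

  The analytic core is the existence of proximal points. The point \<open>prox h x\<close> is sought as the
  minimiser of \<open>h z + \<parallel>z - x\<parallel>\<^sup>2 / 2\<close>. This function is bounded below because \<open>h\<close> decreases at most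
  linearly (\<open>Gamma0_linear_lower_bound\<close>). By strong convexity minimising sequences are Cauchy, and
  by lower semicontinuity their limits are minimisers (\<open>midpoint_strongly_convex_attains_min\<close>). The
  first-order condition along segments from the minimiser, where the quadratic remainder vanishes,
  is the subgradient inequality.
\<close>

section \<open>Sums of functions in \<open>\<Gamma>\<^sub>0\<close>\<close>

lemma lower_semicontinuous_iff:
  "lower_semicontinuous h \<longleftrightarrow> (\<forall>x. \<forall>c<h x. \<forall>\<^sub>F z in nhds x. c < h z)"
  by (simp add: lower_semicontinuous_def le_Liminf_iff)

lemma continuous_imp_lower_semicontinuous:
  assumes "continuous_on UNIV q"
  shows "lower_semicontinuous (\<lambda>z. ereal (q z))"
  unfolding lower_semicontinuous_iff
proof (intro allI impI)
  fix x c assume c: "c < ereal (q x)"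
  have "((\<lambda>z. ereal (q z)) \<longlongrightarrow> ereal (q x)) (nhds x)"
    using assms by (simp add: continuous_on_def tendsto_at_iff_tendsto_nhds)
  then show "\<forall>\<^sub>F z in nhds x. c < ereal (q z)"
    using c by (rule order_tendstoD)
qed

lemma ereal_less_add_split:
  fixes a b c :: ereal
  assumes "c < a + b" "a \<noteq> -\<infinity>" "b \<noteq> -\<infinity>"
  obtains s t where "s < a" "t < b" "\<And>a' b'. s < a' \<Longrightarrow> t < b' \<Longrightarrow> c < a' + b'"
proof -
  obtain r where r: "c < ereal r" "ereal r < a + b"
    using assms(1) ereal_dense2 by blast
  have "\<exists>s t. ereal s < a \<and> ereal t < b \<and> r = s + t"
  proof (cases a)
    case (real \<alpha>)
    show ?thesis
    proof (cases b)
      case (real \<beta>)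
      define d where "d = (\<alpha> + \<beta> - r) / 2"
      have "d > 0" using r real \<open>a = ereal \<alpha>\<close> by (simp add: d_def)
      then show ?thesis using real \<open>a = ereal \<alpha>\<close>
        by (intro exI[of _ "\<alpha> - d"] exI[of _ "\<beta> - d"]) (simp add: d_def field_simps)
    next
      case PInf
      then show ?thesis using real
        by (intro exI[of _ "\<alpha> - 1"] exI[of _ "r - \<alpha> + 1"]) simp
    qed (use assms in simp)
  next
    case PInf
    obtain t where "ereal t < b"
      using assms(3) ereal_dense2[of "-\<infinity>" b] by auto
    then show ?thesis using PInf
      by (intro exI[of _ "r - t"] exI[of _ t]) simp
  qed (use assms in simp)
  then obtain s t where st: "ereal s < a" "ereal t < b" "r = s + t" by blast
  have "c < a' + b'" if "ereal s < a'" "ereal t < b'" for a' b'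
  proof -
    have "ereal r < a' + b'"
      using that st(3) by (cases a'; cases b') auto
    with r(1) show ?thesis by (rule less_trans)
  qed
  with st that show ?thesis by blast
qed

lemma lower_semicontinuous_add:
  assumes "lower_semicontinuous f" "lower_semicontinuous g"
    and "\<And>x. f x \<noteq> -\<infinity>" "\<And>x. g x \<noteq> -\<infinity>"
  shows "lower_semicontinuous (\<lambda>x. f x + g x)"
  unfolding lower_semicontinuous_iff
proof (intro allI impI)
  fix x c assume "c < f x + g x"
  then obtain s t where st: "s < f x" "t < g x"
      "\<And>a b. s < a \<Longrightarrow> t < b \<Longrightarrow> c < a + b"
    using ereal_less_add_split assms(3,4) by metis
  have "\<forall>\<^sub>F z in nhds x. s < f z" "\<forall>\<^sub>F z in nhds x. t < g z"
    using assms(1,2) st(1,2) by (auto simp: lower_semicontinuous_iff)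
  then show "\<forall>\<^sub>F z in nhds x. c < f z + g z"
    by eventually_elim (rule st(3))
qed

lemma convex_fun_add:
  assumes "convex_fun f" "convex_fun g"
  shows "convex_fun (\<lambda>x. f x + g x)"
  unfolding convex_fun_def
proof (intro allI impI)
  fix x y and u v :: real assume uv: "0 \<le> u" "0 \<le> v" "u + v = 1"
  have "f (u *\<^sub>R x + v *\<^sub>R y) + g (u *\<^sub>R x + v *\<^sub>R y)
      \<le> (ereal u * f x + ereal v * f y) + (ereal u * g x + ereal v * g y)"
    using assms uv by (intro add_mono) (auto simp: convex_fun_def)
  also have "\<dots> = ereal u * (f x + g x) + ereal v * (f y + g y)"
    using uv by (simp add: ereal_pos_distrib ac_simps)
  finally show "f (u *\<^sub>R x + v *\<^sub>R y) + g (u *\<^sub>R x + v *\<^sub>R y)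
      \<le> ereal u * (f x + g x) + ereal v * (f y + g y)" .
qed

lemma Gamma0_add:
  assumes "f \<in> Gamma0" "g \<in> Gamma0" "effective_domain f \<inter> effective_domain g \<noteq> {}"
  shows "(\<lambda>x. f x + g x) \<in> Gamma0"
  using assms lower_semicontinuous_add[of f g] convex_fun_add[of f g]
  by (auto simp: Gamma0_def proper_def effective_domain_def)

section \<open>Existence of proximal points\<close>

lemma convex_fun_real_bound:
  assumes "convex_fun h" "\<And>z. h z \<noteq> -\<infinity>" "h x = ereal a" "h y = ereal b"
    and "0 \<le> u" "0 \<le> v" "u + v = 1"
  obtains c where "h (u *\<^sub>R x + v *\<^sub>R y) = ereal c" "c \<le> u * a + v * b"
proof -
  have "h (u *\<^sub>R x + v *\<^sub>R y) \<le> ereal (u * a + v * b)"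
    using assms(1)[unfolded convex_fun_def, rule_format, of u v x y] assms(3-) by simp
  then show ?thesis
    using that assms(2)[of "u *\<^sub>R x + v *\<^sub>R y"] by (cases "h (u *\<^sub>R x + v *\<^sub>R y)") auto
qed

text \<open>
  Semicontinuity bounds \<open>h\<close> from below on a small ball around a point \<open>x\<^sub>0\<close> of its domain. A far
  point \<open>z\<close> where \<open>h\<close> lies too far below \<open>h x\<^sub>0\<close> would, by convexity, pull \<open>h\<close> below that bound at
  the point where the segment from \<open>x\<^sub>0\<close> to \<open>z\<close> leaves a smaller ball. This takes the place of
  an affine minorant and avoids separation theorems.
\<close>
lemma Gamma0_linear_lower_bound:
  assumes "h \<in> Gamma0"
  obtains x\<^sub>0 a K where "\<And>z. ereal (a - K * norm (z - x\<^sub>0)) \<le> h z"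
proof -
  have ninf: "\<And>z. h z \<noteq> -\<infinity>" and conv: "convex_fun h" and lsc: "lower_semicontinuous h"
    using assms by (auto simp: Gamma0_def proper_def)
  obtain x\<^sub>0 where "h x\<^sub>0 < \<infinity>"
    using assms by (auto simp: Gamma0_def proper_def effective_domain_def)
  then obtain c where c: "h x\<^sub>0 = ereal c"
    using ninf[of x\<^sub>0] by (cases "h x\<^sub>0") auto
  have "\<forall>\<^sub>F z in nhds x\<^sub>0. ereal (c - 1) < h z"
    using lsc c by (auto simp: lower_semicontinuous_iff)
  then obtain e where e: "e > 0" "\<And>z. dist z x\<^sub>0 < e \<Longrightarrow> ereal (c - 1) < h z"
    by (auto simp: eventually_nhds_metric)
  define r where "r = e / 2"
  have r: "0 < r" "r < e" using e by (auto simp: r_def)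
  have "ereal (c - 1 - 1 / r * norm (z - x\<^sub>0)) \<le> h z" for z
  proof (cases "dist z x\<^sub>0 < e")
    case True
    have "ereal (c - 1 - 1 / r * norm (z - x\<^sub>0)) \<le> ereal (c - 1)" using r by simp
    also have "\<dots> \<le> h z" using e(2)[OF True] by simp
    finally show ?thesis .
  next
    case far: False
    show ?thesis
    proof (cases "h z")
      case (real b)
      define n where "n = norm (z - x\<^sub>0)"
      define t where "t = r / n"
      have n: "n \<ge> e" "n > 0" using far e by (auto simp: n_def dist_norm)
      have t: "0 < t" "t \<le> 1" using r n by (auto simp: t_def)
      obtain w where w: "h ((1 - t) *\<^sub>R x\<^sub>0 + t *\<^sub>R z) = ereal w" "w \<le> (1 - t) * c + t * b"
        using convex_fun_real_bound[OF conv ninf c real, of "1 - t" t] t by auto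
      have "dist ((1 - t) *\<^sub>R x\<^sub>0 + t *\<^sub>R z) x\<^sub>0 = norm (t *\<^sub>R (z - x\<^sub>0))"
        by (simp add: dist_norm algebra_simps)
      also have "\<dots> = r" using t n by (simp add: n_def[symmetric]) (simp add: t_def)
      finally have "c - 1 < w" using e(2) r w(1) by fastforce
      with w(2) have "t * (c - b) < 1" by (simp add: algebra_simps)
      then have "c - b < 1 / t" using t by (simp add: field_simps)
      then show ?thesis using real by (simp add: t_def n_def)
    qed (use ninf in auto)
  qed
  with that show ?thesis by blast
qed

text \<open>
  The convexity hypothesis is the sublevel form of strong convexity with modulus 1. It makes almost
  minimal points close to each other: if \<open>\<phi>\<close> is at most \<open>inf \<phi> + \<epsilon>\<close> at \<open>a\<close> and \<open>b\<close>, then its value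
  at the midpoint, which is at least \<open>inf \<phi>\<close>, gives \<open>(dist a b)\<^sup>2 \<le> 8 \<epsilon>\<close>.
\<close>
lemma midpoint_strongly_convex_attains_min:
  fixes \<phi> :: "'h::{real_inner, complete_space} \<Rightarrow> ereal"
  assumes lsc: "lower_semicontinuous \<phi>"
    and bounded: "\<And>z. ereal l \<le> \<phi> z"
    and finite: "\<phi> z\<^sub>0 < \<infinity>"
    and mid: "\<And>a b s. \<phi> a \<le> ereal s \<Longrightarrow> \<phi> b \<le> ereal s \<Longrightarrow>
                \<phi> (midpoint a b) \<le> ereal (s - (dist a b)\<^sup>2 / 8)"
  obtains p where "\<And>z. \<phi> p \<le> \<phi> z"
proof -
  have "ereal l \<le> (INF z. \<phi> z)" using bounded by (simp add: le_INF_iff)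
  moreover have "(INF z. \<phi> z) < \<infinity>" unfolding INF_less_iff using finite by blast
  ultimately obtain m where m: "(INF z. \<phi> z) = ereal m"
    by (cases "INF z. \<phi> z") auto
  have m_le: "ereal m \<le> \<phi> z" for z
    unfolding m[symmetric] by (rule INF_lower) simp
  have "\<exists>z. \<phi> z < ereal (m + 1 / Suc n)" for n
  proof -
    have "(INF z. \<phi> z) < ereal (m + 1 / Suc n)" unfolding m by simp
    then show ?thesis by (simp add: INF_less_iff)
  qed
  then obtain Z where Z: "\<And>n. \<phi> (Z n) < ereal (m + 1 / Suc n)" by metis
  have Z_le: "\<phi> (Z i) \<le> ereal (m + 1 / Suc N)" if "N \<le> i" for i N
  proof -
    have "\<phi> (Z i) \<le> ereal (m + 1 / Suc i)" using Z by (rule less_imp_le)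
    also have "\<dots> \<le> ereal (m + 1 / Suc N)" using that by (simp add: field_simps)
    finally show ?thesis .
  qed
  have dist_Z: "(dist (Z i) (Z j))\<^sup>2 \<le> 8 / Suc N" if "N \<le> i" "N \<le> j" for i j N
    using order_trans[OF m_le mid[OF Z_le[OF that(1)] Z_le[OF that(2)]]] by simp
  have "Cauchy Z"
  proof (rule metric_CauchyI)
    fix e :: real assume "0 < e"
    then obtain N where N: "inverse (real (Suc N)) < e\<^sup>2 / 8"
      using reals_Archimedean[of "e\<^sup>2 / 8"] by auto
    have "dist (Z i) (Z j) < e" if "N \<le> i" "N \<le> j" for i j
    proof -
      have "(dist (Z i) (Z j))\<^sup>2 < e\<^sup>2"
        using dist_Z[OF that] N by (simp add: inverse_eq_divide)
      then show ?thesis using \<open>0 < e\<close> by (simp add: power_less_imp_less_base)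
    qed
    then show "\<exists>N. \<forall>i\<ge>N. \<forall>j\<ge>N. dist (Z i) (Z j) < e" by blast
  qed
  then obtain p where p: "Z \<longlonglongrightarrow> p"
    using Cauchy_convergent_iff convergent_def by blast
  have "\<phi> p \<le> ereal m"
  proof (rule ccontr)
    assume "\<not> \<phi> p \<le> ereal m"
    then obtain c where c: "m < c" "ereal c < \<phi> p"
      using ereal_dense2[of "ereal m" "\<phi> p"] by (auto simp: not_le)
    have "\<forall>\<^sub>F n in sequentially. ereal c < \<phi> (Z n)"
      using lsc c(2) p by (auto simp: lower_semicontinuous_iff filterlim_iff)
    then obtain N\<^sub>1 where N1: "\<And>n. n \<ge> N\<^sub>1 \<Longrightarrow> ereal c < \<phi> (Z n)"
      by (auto simp: eventually_sequentially)
    obtain N\<^sub>2 where N2: "inverse (real (Suc N\<^sub>2)) < c - m"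
      using reals_Archimedean[of "c - m"] c(1) by auto
    have "ereal c < ereal (m + 1 / Suc N\<^sub>2)"
      using N1[of "max N\<^sub>1 N\<^sub>2"] Z_le[of N\<^sub>2 "max N\<^sub>1 N\<^sub>2"] by (meson less_le_trans max.cobounded1 max.cobounded2)
    then show False using N2 by (simp add: inverse_eq_divide)
  qed
  with m_le that show ?thesis by (meson order_trans)
qed

text \<open>
  If \<open>p\<close> minimises \<open>h z + \<parallel>z - x\<parallel>\<^sup>2 / 2\<close>, comparing \<open>p\<close> with \<open>p + t (z - p)\<close> and dividing by \<open>t\<close>
  gives the subgradient inequality for \<open>x - p\<close> up to the error \<open>t \<parallel>z - p\<parallel>\<^sup>2 / 2\<close>.
\<close>
lemma quadratic_minimiser_mem_prox:
  assumes conv: "convex_fun h" and proper: "proper h"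
    and minimal: "\<And>z. h p + ereal ((norm (p - x))\<^sup>2 / 2) \<le> h z + ereal ((norm (z - x))\<^sup>2 / 2)"
  shows "p \<in> prox h x"
proof -
  have ninf: "\<And>z. h z \<noteq> -\<infinity>" using proper by (auto simp: proper_def)
  obtain z\<^sub>0 where "h z\<^sub>0 < \<infinity>" using proper by (auto simp: proper_def effective_domain_def)
  then have "h p \<noteq> \<infinity>" using minimal[of z\<^sub>0] by auto
  then obtain a where a: "h p = ereal a" using ninf[of p] by (cases "h p") auto
  have "ereal ((x - p) \<bullet> (z - p)) \<le> h z - h p" for z
  proof (cases "h z")
    case (real b)
    have step: "(x - p) \<bullet> (z - p) \<le> b - a + t * ((norm (z - p))\<^sup>2 / 2)" if t: "0 < t" "t < 1" for t
    proof -
      obtain w where w: "h ((1 - t) *\<^sub>R p + t *\<^sub>R z) = ereal w" "w \<le> (1 - t) * a + t * b"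
        using convex_fun_real_bound[OF conv ninf a real, of "1 - t" t] t by auto
      have eq: "(1 - t) *\<^sub>R p + t *\<^sub>R z - x = (p - x) + t *\<^sub>R (z - p)"
        by (simp add: algebra_simps)
      have "a + (norm (p - x))\<^sup>2 / 2 \<le> w + (norm ((p - x) + t *\<^sub>R (z - p)))\<^sup>2 / 2"
        using minimal[of "(1 - t) *\<^sub>R p + t *\<^sub>R z"] unfolding eq by (simp add: a w(1))
      moreover have "(norm ((p - x) + t *\<^sub>R (z - p)))\<^sup>2
          = (norm (p - x))\<^sup>2 - 2 * (t * ((x - p) \<bullet> (z - p))) + t * (t * (norm (z - p))\<^sup>2)"
        unfolding power2_norm_eq_inner
        by (simp add: inner_diff_left inner_diff_right inner_add_left inner_add_right
            inner_commute algebra_simps)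
      ultimately have "t * ((x - p) \<bullet> (z - p)) \<le> t * (b - a + t * ((norm (z - p))\<^sup>2 / 2))"
        using w(2) by (simp add: algebra_simps)
      then show ?thesis using t by simp
    qed
    have "((\<lambda>t. b - a + t * ((norm (z - p))\<^sup>2 / 2)) \<longlongrightarrow> b - a + 0 * ((norm (z - p))\<^sup>2 / 2)) (at_right 0)"
      by (intro tendsto_intros)
    moreover have "\<forall>\<^sub>F t in at_right 0. (x - p) \<bullet> (z - p) \<le> b - a + t * ((norm (z - p))\<^sup>2 / 2)"
      using step by (auto simp: eventually_at_right_field intro!: exI[of _ 1])
    ultimately have "(x - p) \<bullet> (z - p) \<le> b - a + 0 * ((norm (z - p))\<^sup>2 / 2)"
      by (rule tendsto_lowerbound) simp
    then show ?thesis by (simp add: a real)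
  qed (use a ninf in auto)
  then show ?thesis by (simp add: mem_prox_iff subdifferential_def)
qed

lemma prox_exists:
  fixes h :: "'h::{real_inner, complete_space} \<Rightarrow> ereal"
  assumes "h \<in> Gamma0"
  shows "\<exists>p. p \<in> prox h x"
proof -
  have ninf: "\<And>z. h z \<noteq> -\<infinity>" and proper: "proper h"
    and conv: "convex_fun h" and lsc: "lower_semicontinuous h"
    using assms by (auto simp: Gamma0_def proper_def)
  define \<phi> where "\<phi> z = h z + ereal ((norm (z - x))\<^sup>2 / 2)" for z
  have "lower_semicontinuous \<phi>"
    unfolding \<phi>_def
    by (intro lower_semicontinuous_add lsc ninf continuous_imp_lower_semicontinuous
        continuous_intros) auto
  moreover obtain x\<^sub>0 a K where aK: "\<And>z. ereal (a - K * norm (z - x\<^sub>0)) \<le> h z"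
    using Gamma0_linear_lower_bound[OF assms] by blast
  have "ereal (a - \<bar>K\<bar> * norm (x - x\<^sub>0) - K\<^sup>2 / 2) \<le> \<phi> z" for z
  proof -
    define n where "n = norm (z - x)"
    have "norm (z - x\<^sub>0) \<le> n + norm (x - x\<^sub>0)"
      using norm_triangle_ineq[of "z - x" "x - x\<^sub>0"] by (simp add: n_def)
    then have "\<bar>K\<bar> * norm (z - x\<^sub>0) \<le> \<bar>K\<bar> * (n + norm (x - x\<^sub>0))"
      by (rule mult_left_mono) simp
    moreover have "K * norm (z - x\<^sub>0) \<le> \<bar>K\<bar> * norm (z - x\<^sub>0)"
      by (rule mult_right_mono) auto
    moreover have "0 \<le> (n - \<bar>K\<bar>)\<^sup>2" by simp
    ultimately have "a - \<bar>K\<bar> * norm (x - x\<^sub>0) - K\<^sup>2 / 2 \<le> (a - K * norm (z - x\<^sub>0)) + n\<^sup>2 / 2"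
      by (simp add: power2_diff algebra_simps)
    then have "ereal (a - \<bar>K\<bar> * norm (x - x\<^sub>0) - K\<^sup>2 / 2)
        \<le> ereal (a - K * norm (z - x\<^sub>0)) + ereal (n\<^sup>2 / 2)" by simp
    also have "\<dots> \<le> \<phi> z" unfolding \<phi>_def n_def by (intro add_mono aK order_refl)
    finally show ?thesis .
  qed
  moreover obtain z\<^sub>0 where "\<phi> z\<^sub>0 < \<infinity>"
    using proper by (auto simp: proper_def effective_domain_def \<phi>_def)
  moreover have "\<phi> (midpoint a b) \<le> ereal (s - (dist a b)\<^sup>2 / 8)"
    if ab: "\<phi> a \<le> ereal s" "\<phi> b \<le> ereal s" for a b s
  proof -
    obtain \<alpha> where \<alpha>: "h a = ereal \<alpha>" using ab(1) ninf[of a] by (cases "h a") (auto simp: \<phi>_def)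
    obtain \<beta> where \<beta>: "h b = ereal \<beta>" using ab(2) ninf[of b] by (cases "h b") (auto simp: \<phi>_def)
    obtain w where w: "h (midpoint a b) = ereal w" "w \<le> \<alpha> / 2 + \<beta> / 2"
      using convex_fun_real_bound[OF conv ninf \<alpha> \<beta>, of "1/2" "1/2"]
      by (auto simp: midpoint_def scaleR_add_right)
    have eq: "midpoint a b - x = (1 / 2) *\<^sub>R ((a - x) + (b - x))"
      by (simp add: midpoint_def algebra_simps flip: scaleR_left_distrib)
    have "(norm (midpoint a b - x))\<^sup>2 / 2
        = (norm (a - x))\<^sup>2 / 4 + (norm (b - x))\<^sup>2 / 4 - (dist a b)\<^sup>2 / 8"
      unfolding eq dist_norm power2_norm_eq_inner
      by (simp add: inner_diff_left inner_diff_right inner_add_left inner_add_right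
          inner_commute field_simps)
    moreover have "\<alpha> + (norm (a - x))\<^sup>2 / 2 \<le> s" "\<beta> + (norm (b - x))\<^sup>2 / 2 \<le> s"
      using ab by (simp_all add: \<phi>_def \<alpha> \<beta>)
    ultimately have "w + (norm (midpoint a b - x))\<^sup>2 / 2 \<le> s - (dist a b)\<^sup>2 / 8"
      using w(2) by linarith
    then show ?thesis by (simp add: \<phi>_def w(1))
  qed
  ultimately obtain p where "\<And>z. \<phi> p \<le> \<phi> z"
    by (rule midpoint_strongly_convex_attains_min) auto
  then have "p \<in> prox h x"
    by (intro quadratic_minimiser_mem_prox conv proper) (simp add: \<phi>_def)
  then show ?thesis ..
qed

section \<open>Surjectivity and additivity\<close>

lemma op_domain_prox_rel_iff:
  "op_domain (prox_rel f g) = UNIV \<longleftrightarrow>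
    (\<forall>x. \<exists>p. x - p \<in> op_add (subdifferential f) (subdifferential g) p)"
proof -
  have "prox_rel f g x \<noteq> {} \<longleftrightarrow>
      (\<exists>p. x - p \<in> op_add (subdifferential f) (subdifferential g) p)" for x
  proof
    assume "prox_rel f g x \<noteq> {}"
    then obtain y p where "y - p \<in> subdifferential f p" "x - y \<in> subdifferential g p"
      by (auto simp: mem_prox_rel_iff mem_prox_iff)
    then have "(y - p) + (x - y) \<in> op_add (subdifferential f) (subdifferential g) p"
      unfolding op_add_def by (rule set_plus_intro)
    then show "\<exists>p. x - p \<in> op_add (subdifferential f) (subdifferential g) p" by auto
  next
    assume "\<exists>p. x - p \<in> op_add (subdifferential f) (subdifferential g) p"
    then obtain p u v where uv: "u \<in> subdifferential f p" "v \<in> subdifferential g p" "x - p = u + v"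
      by (auto simp: op_add_def elim: set_plus_elim)
    have "x - (p + u) = v" using uv(3) by (simp add: algebra_simps)
    then have "p + u \<in> prox_rel f g x"
      using uv(1,2) by (auto simp: mem_prox_rel_iff mem_prox_iff intro!: bexI[of _ p])
    then show "prox_rel f g x \<noteq> {}" by auto
  qed
  then show ?thesis by (auto simp: op_domain_def)
qed

lemma op_add_subdifferential_subset:
  assumes "proper f" "proper g"
  shows "op_add (subdifferential f) (subdifferential g) x \<subseteq> subdifferential (\<lambda>x. f x + g x) x"
proof
  fix w assume "w \<in> op_add (subdifferential f) (subdifferential g) x"
  then obtain u v where uv: "u \<in> subdifferential f x" "v \<in> subdifferential g x" "w = u + v"
    by (auto simp: op_add_def elim: set_plus_elim)
  obtain a b where ab: "f x = ereal a" "g x = ereal b"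
    using subdifferential_finite[OF assms(1) uv(1)] subdifferential_finite[OF assms(2) uv(2)]
    by (cases "f x"; cases "g x") auto
  have "ereal (w \<bullet> (z - x)) \<le> f z + g z - (f x + g x)" for z
  proof -
    have "ereal (u \<bullet> (z - x)) \<le> f z - f x" "ereal (v \<bullet> (z - x)) \<le> g z - g x"
      using uv(1,2) by (auto simp: subdifferential_def)
    then show ?thesis
      by (cases "f z"; cases "g z") (auto simp: ab uv(3) inner_add_left)
  qed
  then show "w \<in> subdifferential (\<lambda>x. f x + g x) x" by (simp add: subdifferential_def)
qed

theorem proposition2p5:
  fixes f g :: "'h::{real_inner, complete_space} \<Rightarrow> ereal"
  assumes "f \<in> Gamma0" and "g \<in> Gamma0"
    and "effective_domain f \<inter> effective_domain g \<noteq> {}"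
  shows "op_domain (prox_rel f g) = UNIV \<longleftrightarrow>
    subdifferential (\<lambda>x. f x + g x) = op_add (subdifferential f) (subdifferential g)"
proof
  let ?h = "\<lambda>x. f x + g x"
  have h: "?h \<in> Gamma0" using assms by (rule Gamma0_add)
  {
    assume full: "op_domain (prox_rel f g) = UNIV"
    have sub: "op_add (subdifferential f) (subdifferential g) p \<subseteq> subdifferential ?h p" for p
      using assms by (intro op_add_subdifferential_subset) (auto simp: Gamma0_def)
    have "u \<in> op_add (subdifferential f) (subdifferential g) p"
      if u: "u \<in> subdifferential ?h p" for u p
    proof -
      obtain q where q: "(p + u) - q \<in> op_add (subdifferential f) (subdifferential g) q"
        using full unfolding op_domain_prox_rel_iff by blast
      have "p \<in> prox ?h (p + u)" using u by (simp add: mem_prox_iff)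
      moreover have "q \<in> prox ?h (p + u)" using q sub by (auto simp: mem_prox_iff)
      ultimately have "p = q" using h by (intro prox_unique[of ?h]) (auto simp: Gamma0_def)
      with q show ?thesis by simp
    qed
    with sub show "subdifferential ?h = op_add (subdifferential f) (subdifferential g)" by blast
  next
    assume eq: "subdifferential ?h = op_add (subdifferential f) (subdifferential g)"
    show "op_domain (prox_rel f g) = UNIV"
      unfolding op_domain_prox_rel_iff eq[symmetric]
      using prox_exists[OF h] by (simp add: mem_prox_iff)
  }
qed

end
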